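(* Let $n\ge2$ and $\sigma\in\mathfrak{S}_n$. Then $$E(\sigma)\le\frac{\ln\left(\max(\mathrm{cyc}(\sigma),2)\right)}{\ln n}.$$
   Context: $\mathrm{cyc}(\sigma)$ is the total number of cycles of $\sigma$, fixed points included. Orbit growth exponent: for $\sigma\in\mathfrak{S}_n$ with $n\ge2$, let $f_i(\sigma)$ be the number of cycles of $\sigma$ of length $i$ (fixed points being cycles of length 1) and $\Sigma_k=\sum_{1\le i\le k} i f_i(\sigma)$. Define $(e_i)_{i\ge1}$ by $n^{e_1+\cdots+e_i}=\max(\Sigma_i,1)$ for all $i\ge1$, and $E(\sigma)=\sum_{i\ge1}\frac{e_i}{i}$. *)

theory Defs
  imports Complex_Main "HOL-Combinatorics.Orbits" "HOL-Combinatorics.Permutations"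
begin

(* The symmetric group S_n consists of the functions s with "s permutes {1..n}".  The library
   orbits of a permutation of a finite set contain their base point, so "orbit s x" is the
   underlying set of the cycle of s through x; fixed points give singletons. *)

definition cycles_of :: "nat \<Rightarrow> (nat \<Rightarrow> nat) \<Rightarrow> nat set set" where
  "cycles_of n \<sigma> = orbit \<sigma> ` {1..n}"

definition cyc :: "nat \<Rightarrow> (nat \<Rightarrow> nat) \<Rightarrow> nat" where
  "cyc n \<sigma> = card (cycles_of n \<sigma>)"

definition cyc_len :: "nat \<Rightarrow> (nat \<Rightarrow> nat) \<Rightarrow> nat \<Rightarrow> nat" where
  "cyc_len n \<sigma> i = card {C \<in> cycles_of n \<sigma>. card C = i}"

definition cyc_mass :: "nat \<Rightarrow> (nat \<Rightarrow> nat) \<Rightarrow> nat \<Rightarrow> nat" where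
  "cyc_mass n \<sigma> k = (\<Sum>i = 1..k. i * cyc_len n \<sigma> i)"

(* The sequence (e_i) is indexed from 1; the unused value at 0 is fixed to be 0. *)

definition is_growth_seq :: "nat \<Rightarrow> (nat \<Rightarrow> nat) \<Rightarrow> (nat \<Rightarrow> real) \<Rightarrow> bool" where
  "is_growth_seq n \<sigma> e \<longleftrightarrow>
     e 0 = 0 \<and> (\<forall>i\<ge>1. real n powr (\<Sum>j = 1..i. e j) = real (max (cyc_mass n \<sigma> i) 1))"

definition growth_seq :: "nat \<Rightarrow> (nat \<Rightarrow> nat) \<Rightarrow> nat \<Rightarrow> real" where
  "growth_seq n \<sigma> = (THE e. is_growth_seq n \<sigma> e)"

definition orbit_growth :: "nat \<Rightarrow> (nat \<Rightarrow> nat) \<Rightarrow> real" where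
  "orbit_growth n \<sigma> = (\<Sum>i. growth_seq n \<sigma> (Suc i) / real (Suc i))"

(* For n \<ge> 2 the description in growth_seq_def is proper, and the series in orbit_growth_def has
   only finitely many nonzero terms. *)

lemma is_growth_seq_iff:
  assumes "n \<ge> 2"
  shows "is_growth_seq n \<sigma> e \<longleftrightarrow>
    e 0 = 0 \<and> (\<forall>i\<ge>1. (\<Sum>j = 1..i. e j) = log (real n) (real (max (cyc_mass n \<sigma> i) 1)))"
  using assms by (force simp: is_growth_seq_def powr_eq_iff log_powr_cancel powr_log_cancel)

lemma ex1_is_growth_seq:
  assumes n: "n \<ge> 2"
  shows "\<exists>!e. is_growth_seq n \<sigma> e"
proof (rule ex_ex1I)
  define L where "L i = log (real n) (real (max (cyc_mass n \<sigma> i) 1))" for i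
  have L0: "L 0 = 0" by (simp add: L_def cyc_mass_def)
  have "(\<Sum>j = 1..i. if j = 0 then 0 else L j - L (j - 1)) = L i" for i
    by (induction i) (simp_all add: L0)
  then show "\<exists>e. is_growth_seq n \<sigma> e"
    unfolding is_growth_seq_iff[OF n] L_def
    by (intro exI[of _ "\<lambda>j. if j = 0 then 0 else L j - L (j - 1)"]) (simp add: L_def)
next
  fix e e' assume e: "is_growth_seq n \<sigma> e" "is_growth_seq n \<sigma> e'"
  have eq: "(\<Sum>j = 1..i. e j) = (\<Sum>j = 1..i. e' j)" for i
    using e n by (cases i) (simp_all add: is_growth_seq_iff del: sum.cl_ivl_Suc)
  show "e = e'"
  proof
    fix i show "e i = e' i"
    proof (cases i)
      case 0
      then show ?thesis using e by (simp add: is_growth_seq_def)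
    next
      case (Suc k)
      then show ?thesis using eq[of i] eq[of k] by simp
    qed
  qed
qed

lemma is_growth_seq_growth_seq:
  "n \<ge> 2 \<Longrightarrow> is_growth_seq n \<sigma> (growth_seq n \<sigma>)"
  unfolding growth_seq_def by (rule theI'[OF ex1_is_growth_seq])

lemma cyc_len_eq_0:
  assumes "\<sigma> permutes {1..n}" "i > n"
  shows "cyc_len n \<sigma> i = 0"
proof -
  have "card C \<le> n" if "C \<in> cycles_of n \<sigma>" for C
  proof -
    from that assms(1) have "C \<subseteq> {1..n}"
      by (auto simp: cycles_of_def dest: permutes_orbit_subset)
    then show ?thesis using card_mono[of "{1..n}" C] by simp
  qed
  then have "{C \<in> cycles_of n \<sigma>. card C = i} = {}" using assms(2) by force
  then show ?thesis unfolding cyc_len_def by (simp only: card.empty)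
qed

lemma growth_seq_eq_0:
  assumes "n \<ge> 2" "\<sigma> permutes {1..n}" "i > n"
  shows "growth_seq n \<sigma> i = 0"
proof -
  obtain k where i: "i = Suc k" "k \<ge> 1" using assms by (cases i) auto
  have "cyc_mass n \<sigma> i = cyc_mass n \<sigma> k"
    using cyc_len_eq_0[OF assms(2,3)] i by (simp add: cyc_mass_def)
  then have "(\<Sum>j = 1..i. growth_seq n \<sigma> j) = (\<Sum>j = 1..k. growth_seq n \<sigma> j)"
    using is_growth_seq_growth_seq[OF assms(1), of \<sigma>] assms(1) i
    by (simp add: is_growth_seq_iff del: sum.cl_ivl_Suc)
  then show ?thesis using i by simp
qed

lemma summable_orbit_growth:
  assumes "n \<ge> 2" "\<sigma> permutes {1..n}"
  shows "summable (\<lambda>i. growth_seq n \<sigma> (Suc i) / real (Suc i))"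
  by (rule summable_finite[of "{..<n}"]) (simp_all add: growth_seq_eq_0[OF assms])

end

(* The weighted increments of ln (max Sigma_i 1) are compared one length at a time with the
   increments of ln (c_i), where c_i counts the cycles of length at most i.  Adding f cycles of
   length k to a total mass S, carried by c \<le> S cycles, costs
   ln (1 + k f / S) / k \<le> ln (1 + f / S) \<le> ln (1 + f / c) by Bernoulli's inequality.
   Only the steps starting from c = 0 or c = 1 need a separate estimate; for c = 1 the exact value
   ln S / S of the sum so far has to be remembered. *)

theory Submission
  imports Defs
begin

lemma ln_one_plus_mult_le:
  fixes x :: real
  assumes "x \<ge> 0" "k \<ge> 1"
  shows "ln (1 + real k * x) / real k \<le> ln (1 + x)"
proof -
  have "ln (1 + real k * x) \<le> ln ((1 + x) ^ k)"
    using assms Bernoulli_inequality[of x k] by (subst ln_le_cancel_iff) (auto intro: add_pos_nonneg)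
  also have "\<dots> = real k * ln (1 + x)"
    using assms by (simp add: ln_realpow)
  finally show ?thesis
    using assms by (simp add: field_simps)
qed

text \<open>Moves the weight \<open>1/k\<close> into an exponent, so that the exceptional steps
  reduce to power inequalities without logarithms.\<close>

lemma ln_divide_le_of_le_power:
  fixes a x :: real
  assumes "a > 0" "x > 0" "k \<ge> 1" "a \<le> x ^ k"
  shows "ln a / real k \<le> ln x"
proof -
  have "ln a \<le> ln (x ^ k)" using assms by simp
  also have "\<dots> = real k * ln x" using assms by (simp add: ln_realpow)
  finally show ?thesis using assms by (simp add: field_simps)
qed

text \<open>For \<open>m \<ge> 2\<close> the ratio \<open>(m + 1) / m\<close> is at most
  \<open>3/2\<close>, so the induction step is immediate and only the values up to 2 are checked by
  hand.\<close>

lemma le_three_halves_power: "real m \<le> (3/2) ^ m"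
proof (induction m)
  case (Suc m)
  show ?case
  proof (cases "m \<ge> 2")
    case True
    then show ?thesis using Suc by simp
  next
    case False
    then have "m = 0 \<or> m = 1" by auto
    then show ?thesis by (auto simp: power2_eq_square)
  qed
qed simp

text \<open>This is \<open>ln 2 / 2 + ln (1 + k/2) / k \<le> ln 2\<close> with the logarithms
  removed: one cycle of length \<open>k\<close> joins a single 2-cycle.\<close>

lemma square_one_plus_half_le_two_power:
  assumes "k \<ge> 3"
  shows "(1 + real k / 2)\<^sup>2 \<le> 2 ^ k"
  using assms
proof (induction k rule: dec_induct)
  case (step k)
  have "2 * 2 \<le> real k * real k" using step by (intro mult_mono) auto
  then have "(1 + real (Suc k) / 2)\<^sup>2 \<le> 2 * (1 + real k / 2)\<^sup>2"
    by (simp add: power2_eq_square field_simps)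
  then show ?case using step by simp
qed (simp add: power2_eq_square)

text \<open>Handles the first occupied length when it carries \<open>f \<ge> 2\<close> cycles. After
  cancelling \<open>f\<close> it follows from \<open>m \<le> 2 ^ (m - 1)\<close>.\<close>

lemma mult_le_power:
  fixes f m :: nat
  assumes "f \<ge> 2" "m \<ge> 1"
  shows "m * f \<le> f ^ m"
proof -
  obtain j where m: "m = Suc j" using assms by (cases m) auto
  have "Suc j \<le> 2 ^ j" using less_exp[of j] by (simp only: Suc_le_eq)
  also have "\<dots> \<le> f ^ j" using assms by (intro power_mono) auto
  finally have "Suc j * f \<le> f ^ j * f" by (rule mult_right_mono) simp
  then show ?thesis using m by (simp add: mult.commute)
qed

lemma ln_add_diff:
  fixes a x :: real
  assumes "a > 0" "x \<ge> 0"
  shows "ln (a + x) - ln a = ln (1 + x / a)"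
proof -
  have "a + x = a * (1 + x / a)" using assms by (simp add: field_simps)
  moreover have "1 + x / a > 0" using assms by (simp add: add_pos_nonneg)
  ultimately show ?thesis using assms by (simp add: ln_mult_pos)
qed

lemma ln_increment_le:
  fixes S k f c :: nat
  assumes "1 \<le> c" "c \<le> S" "k \<ge> 1"
  shows "(ln (real (S + k * f)) - ln (real S)) / real k \<le> ln (real (c + f)) - ln (real c)"
proof -
  have "ln (real (S + k * f)) - ln (real S) = ln (1 + real k * (real f / real S))"
    using assms ln_add_diff[of "real S" "real (k * f)"] by simp
  then have "(ln (real (S + k * f)) - ln (real S)) / real k \<le> ln (1 + real f / real S)"
    using ln_one_plus_mult_le[of "real f / real S" k] assms by simp
  also have "\<dots> \<le> ln (1 + real f / real c)"
    using assms by (subst ln_le_cancel_iff) (auto intro!: divide_left_mono add_pos_nonneg)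
  also have "\<dots> = ln (real (c + f)) - ln (real c)"
    using assms ln_add_diff[of "real c" "real f"] by simp
  finally show ?thesis .
qed

text \<open>For \<^term>\<open>m = 2\<close> and \<^term>\<open>f = 1\<close> Bernoulli's inequality is too weak and
  \<^term>\<open>k > m\<close> has to be used.\<close>

lemma ln_increment_one_cycle_le:
  fixes m k f :: nat
  assumes "1 \<le> m" "m < k" "f \<ge> 1"
  shows "ln (real m) / real m + (ln (real (m + k * f)) - ln (real m)) / real k \<le> ln (1 + real f)"
proof -
  have eq: "ln (real (m + k * f)) - ln (real m) = ln (1 + real k * (real f / real m))"
    using assms ln_add_diff[of "real m" "real (k * f)"] by simp
  have le: "(ln (real (m + k * f)) - ln (real m)) / real k \<le> ln (1 + real f / real m)"
    unfolding eq using ln_one_plus_mult_le[of "real f / real m" k] assms by simp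
  consider "m = 1" | "m = 2" "f = 1" | "m = 2" "f \<ge> 2" | "m \<ge> 3" using assms by linarith
  then show ?thesis
  proof cases
    case 1
    then show ?thesis using le by simp
  next
    case 2
    have "ln ((1 + real k / 2)\<^sup>2) / real k \<le> ln 2"
      using assms 2 square_one_plus_half_le_two_power[of k]
      by (intro ln_divide_le_of_le_power) (auto intro: add_pos_nonneg zero_less_power)
    also have "ln ((1 + real k / 2)\<^sup>2) = 2 * ln (1 + real k / 2)"
      by (simp add: ln_realpow add_pos_nonneg)
    finally show ?thesis using eq 2 by simp
  next
    case 3
    \<comment> \<open>After Bernoulli, \<open>ln 2 / 2 + ln (1 + f/2) \<le> ln (1 + f)\<close>
      remains. Doubled and exponentiated, it amounts to \<open>2 \<le> f * f\<close>, which fails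
      for \<open>f = 1\<close>.\<close>
    have "2 * 2 \<le> real f * real f" using 3 by (intro mult_mono) auto
    then have "2 * (1 + real f / 2)\<^sup>2 \<le> (1 + real f)\<^sup>2"
      by (simp add: power2_eq_square field_simps)
    then have "ln (2 * (1 + real f / 2)\<^sup>2) \<le> ln ((1 + real f)\<^sup>2)"
      by (subst ln_le_cancel_iff) (auto intro: add_pos_nonneg zero_less_power)
    also have "\<dots> = 2 * ln (1 + real f)"
      by (simp add: ln_realpow)
    also have "ln (2 * (1 + real f / 2)\<^sup>2) = ln 2 + 2 * ln (1 + real f / 2)"
      by (subst ln_mult_pos) (auto simp: ln_realpow add_pos_nonneg)
    finally show ?thesis using le 3 by simp
  next
    case 4
    \<comment> \<open>The constant 3/2 serves both terms: it bounds \<open>ln m / m\<close>, and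
      \<open>3/2 * (1 + f/3) = 3/2 + f/2\<close> is at most \<open>1 + f\<close> exactly when
      \<open>f \<ge> 1\<close>.\<close>
    have "ln (real m) / real m \<le> ln (3/2)"
      using assms le_three_halves_power[of m] by (intro ln_divide_le_of_le_power) auto
    with le have "ln (real m) / real m + (ln (real (m + k * f)) - ln (real m)) / real k
        \<le> ln (3/2) + ln (1 + real f / real m)" by linarith
    also have "\<dots> \<le> ln (3/2) + ln (1 + real f / 3)"
    proof -
      have "real f / real m \<le> real f / 3" using 4 by (intro divide_left_mono) auto
      then show ?thesis by (simp add: add_pos_nonneg del: times_divide_eq_right)
    qed
    also have "\<dots> = ln (3/2 * (1 + real f / 3))"
      by (subst ln_mult_pos) (auto simp: add_pos_nonneg)
    also have "\<dots> \<le> ln (1 + real f)"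
      using assms by (subst ln_le_cancel_iff) (auto intro: add_pos_nonneg)
    finally show ?thesis .
  qed
qed

lemma weighted_ln_increments_le:
  fixes f :: "nat \<Rightarrow> nat" and k :: nat
  defines "S \<equiv> \<lambda>k. \<Sum>i = 1..k. i * f i"
  defines "c \<equiv> \<lambda>k. \<Sum>i = 1..k. f i"
  defines "L \<equiv> \<lambda>k. ln (real (max (S k) 1))"
  shows "(\<Sum>i<k. (L (Suc i) - L i) / real (Suc i)) \<le> ln (real (max (c k) 2))"
proof -
  define A where "A k = (\<Sum>i<k. (L (Suc i) - L i) / real (Suc i))" for k
  have S_Suc: "S (Suc k) = S k + Suc k * f (Suc k)" for k by (simp add: S_def)
  have c_Suc: "c (Suc k) = c k + f (Suc k)" for k by (simp add: c_def)
  have A_Suc: "A (Suc k) = A k + (L (Suc k) - L k) / real (Suc k)" for k by (simp add: A_def)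
  have cS: "c k \<le> S k" for k unfolding c_def S_def by (intro sum_mono) auto
  \<comment> \<open>Read \<open>f i\<close> as the number of cycles of length \<open>i\<close>. For
    \<open>c k = 1\<close> the only cycle has length \<open>S k\<close>, and
    \<open>S k \<le> k\<close> makes it shorter than any cycle added later. Its contribution
    \<open>ln (S k) / S k\<close> may exceed \<open>ln 1 = 0\<close>, so the bound
    \<open>ln (c k)\<close> is claimed only from 2 on.\<close>
  have inv: "(c k = 0 \<longrightarrow> S k = 0 \<and> A k = 0) \<and>
    (c k = 1 \<longrightarrow> S k \<le> k \<and> A k = ln (real (S k)) / real (S k)) \<and>
    (c k \<ge> 2 \<longrightarrow> A k \<le> ln (real (c k)))" for k
  proof (induction k)
    case 0
    show ?case by (simp add: c_def S_def A_def)
  next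
    case (Suc k)
    define F where "F = f (Suc k)"
    have LS: "L k = ln (real (S k))" if "c k \<ge> 1" for k
      using that cS[of k] by (simp add: L_def max_def)
    consider "F = 0" | "F = 1" "c k = 0" | "F \<ge> 2" "c k = 0" | "F \<ge> 1" "c k = 1"
      | "F \<ge> 1" "c k \<ge> 2" by linarith
    then show ?case
    proof cases
      case 1
      then show ?thesis using Suc by (auto simp: S_Suc c_Suc A_Suc F_def L_def)
    next
      case 2
      then show ?thesis using Suc by (auto simp: S_Suc c_Suc A_Suc F_def L_def)
    next
      case 3
      then have S: "S (Suc k) = Suc k * F" "S k = 0" "A k = 0" "c (Suc k) = F"
        using Suc by (auto simp: S_Suc c_Suc F_def)
      \<comment> \<open>Here \<open>S k = 0\<close>, so \<open>L k = ln 1 = 0\<close> and the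
        increment is the full \<open>ln (Suc k * F)\<close>.\<close>
      have "real (Suc k * F) \<le> real F ^ Suc k"
        using mult_le_power[of F "Suc k"] 3
        by (simp only: of_nat_power[symmetric] of_nat_le_iff)
      then have "ln (real (Suc k * F)) / real (Suc k) \<le> ln (real F)"
        using 3 by (intro ln_divide_le_of_le_power) (auto simp del: of_nat_mult power_Suc)
      moreover have "A (Suc k) = ln (real (Suc k * F)) / real (Suc k)"
      proof -
        have "1 \<le> Suc k * F" using 3 by simp
        then show ?thesis
          by (simp add: A_Suc L_def S max_absorb1 del: of_nat_mult of_nat_Suc mult_Suc)
      qed
      ultimately show ?thesis using 3 S by simp
    next
      case 4
      then have IH: "S k \<le> k" "A k = ln (real (S k)) / real (S k)" using Suc by auto
      have "1 \<le> S k" using cS[of k] 4 by simp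
      then have "A (Suc k) \<le> ln (1 + real F)"
        using ln_increment_one_cycle_le[of "S k" "Suc k" F] IH 4
          LS[of k] LS[of "Suc k"] c_Suc[of k]
        by (simp add: A_Suc S_Suc[folded F_def] F_def[symmetric] del: of_nat_Suc mult_Suc)
      then show ?thesis using 4 by (simp add: c_Suc F_def)
    next
      case 5
      then have "A k \<le> ln (real (c k))" using Suc by auto
      moreover have "(L (Suc k) - L k) / real (Suc k) \<le> ln (real (c (Suc k))) - ln (real (c k))"
        using ln_increment_le[of "c k" "S k" "Suc k" F] cS[of k] 5
          LS[of k] LS[of "Suc k"] c_Suc[of k]
        by (simp add: S_Suc F_def del: of_nat_Suc mult_Suc)
      ultimately show ?thesis using 5 by (simp add: c_Suc A_Suc)
    qed
  qed
  consider "c k = 0" | "c k = 1" | "c k \<ge> 2" by linarith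
  then have "A k \<le> ln (real (max (c k) 2))"
  proof cases
    case 1
    then show ?thesis using inv[of k] by simp
  next
    case 2
    \<comment> \<open>The maximum with 2 in the bound absorbs a single cycle, since
      \<open>ln m / m \<le> ln 2\<close>.\<close>
    have "real (S k) \<le> 2 ^ S k" by (rule less_imp_le) (rule of_nat_less_two_power)
    then have "ln (real (S k)) / real (S k) \<le> ln 2"
      using cS[of k] 2 by (intro ln_divide_le_of_le_power) auto
    then show ?thesis using inv[of k] 2 by simp
  next
    case 3
    then show ?thesis using inv[of k] by (simp add: max_def)
  qed
  then show ?thesis by (simp add: A_def)
qed

lemma sum_cyc_len_le_cyc: "(\<Sum>i = 1..k. cyc_len n \<sigma> i) \<le> cyc n \<sigma>"
proof -
  have fin: "finite (cycles_of n \<sigma>)" by (simp add: cycles_of_def)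
  have "(\<Sum>i = 1..k. cyc_len n \<sigma> i) = card (\<Union>i\<in>{1..k}. {C \<in> cycles_of n \<sigma>. card C = i})"
    unfolding cyc_len_def using fin by (subst card_UN_disjoint) auto
  also have "\<dots> \<le> cyc n \<sigma>"
    unfolding cyc_def using fin by (intro card_mono) auto
  finally show ?thesis .
qed

lemma growth_seq_Suc:
  assumes "n \<ge> 2"
  shows "growth_seq n \<sigma> (Suc i) =
    (ln (real (max (cyc_mass n \<sigma> (Suc i)) 1)) - ln (real (max (cyc_mass n \<sigma> i) 1))) / ln (real n)"
proof -
  have "(\<Sum>j = 1..i. growth_seq n \<sigma> j) = ln (real (max (cyc_mass n \<sigma> i) 1)) / ln (real n)" for i
  proof (cases "i = 0")
    \<comment> \<open>The defining relation starts at index 1. At 0 the empty sum agrees with the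
      formula because the mass is 0 and the maximum with 1 gives \<open>ln 1 = 0\<close>.\<close>
    case True
    then show ?thesis by (simp add: cyc_mass_def)
  next
    case False
    then show ?thesis
      using is_growth_seq_growth_seq[OF assms, of \<sigma>] unfolding is_growth_seq_iff[OF assms]
      by (simp add: log_def del: of_nat_max)
  qed
  from this[of "Suc i"] this[of i] show ?thesis
    by (simp add: diff_divide_distrib del: of_nat_max)
qed

theorem proposition5p1:
  fixes n :: nat and \<sigma> :: "nat \<Rightarrow> nat"
  assumes "n \<ge> 2" and "\<sigma> permutes {1..n}"
  shows "orbit_growth n \<sigma> \<le> ln (real (max (cyc n \<sigma>) 2)) / ln (real n)"
proof -
  define L where "L k = ln (real (max (cyc_mass n \<sigma> k) 1))" for k
  \<comment> \<open>No cycle is longer than \<open>n\<close>, so the series stops there.\<close>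
  have "orbit_growth n \<sigma> = (\<Sum>i<n. growth_seq n \<sigma> (Suc i) / real (Suc i))"
    unfolding orbit_growth_def
    by (rule suminf_finite) (simp_all add: growth_seq_eq_0[OF assms])
  also have "\<dots> = (\<Sum>i<n. (L (Suc i) - L i) / real (Suc i)) / ln (real n)"
    by (simp add: growth_seq_Suc[OF assms(1)] L_def sum_divide_distrib mult.commute
        del: of_nat_max of_nat_Suc)
  \<comment> \<open>With \<open>f = cyc_len n \<sigma>\<close> the weighted sum \<open>S\<close> of
    the general inequality is \<open>cyc_mass n \<sigma>\<close>.\<close>
  also have "\<dots> \<le> ln (real (max (\<Sum>i = 1..n. cyc_len n \<sigma> i) 2)) / ln (real n)"
    using weighted_ln_increments_le[of "cyc_len n \<sigma>" n] assms(1)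
    unfolding L_def cyc_mass_def by (intro divide_right_mono) auto
  also have "\<dots> \<le> ln (real (max (cyc n \<sigma>) 2)) / ln (real n)"
    using sum_cyc_len_le_cyc[of n \<sigma> n] assms(1) by (intro divide_right_mono) auto
  finally show ?thesis .
qed

end
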